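(* Let $H$ be a fixed graph with $H \neq P_2 + sP_1$ for $s \in \{0,1,2\}$ and $H \neq sP_1$ for $s \in \{1,2,3\}$. Then any streaming algorithm for \textsc{Diameter} in the AL model that uses $p$ passes over the stream must use $\Omega(n/p)$ bits of memory on $n$-vertex graphs $G$, even when the algorithm is given a set $X \subseteq V(G)$ of constant size such that $G - X$ is $H$-free. If moreover $H \neq P_3$, the same lower bound holds even when it is additionally required that $G - X$ is connected (and $H$-free).
   Context: Graphs are finite, simple, undirected, unweighted. $P_a$ is the path on $a$ vertices; $G_1+G_2$ is the disjoint union, and $sG$ is the disjoint union of $s$ copies of $G$. $G$ is $H$-free if it has no induced subgraph isomorphic to $H$; $G-X$ is the graph obtained by deleting the vertices of $X$. \textsc{Diameter}: compute $\max_{s,t} d(s,t)$ (shortest-path distance). In the Adjacency List (AL) streaming model the graph arrives as a sequence of vertices in arbitrary fixed order, each together with the full list of its incident edges (each edge appears twice). A $p$-pass algorithm reads the sequence $p$ times with unlimited computation; memory is measured in bits. "Must use $\Omega(f)$ bits" means there is a constant $c>0$ such that every $p$-pass algorithm solving the problem correctly on all inputs of the stated class uses at least $c\cdot f$ bits on some $n$-vertex input, for all sufficiently large $n$ and all $p$. *)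

theory Defs
  imports "Graph_Theory.Graph_Theory"
begin

text \<open>
  A finite simple undirected graph is a \<open>pair_graph\<close>: a finite symmetric loop-free digraph,
  in which every edge is represented by its two orientations.
\<close>

definition path_graph :: "nat \<Rightarrow> nat pair_pre_digraph" where
  "path_graph a = \<lparr> pverts = {0..<a},
     parcs = {(i, j). i < a \<and> j < a \<and> (j = Suc i \<or> i = Suc j)} \<rparr>"

definition disjoint_union ::
  "'a pair_pre_digraph \<Rightarrow> 'b pair_pre_digraph \<Rightarrow> ('a + 'b) pair_pre_digraph" where
  "disjoint_union G1 G2 = \<lparr> pverts = pverts G1 <+> pverts G2,
     parcs = map_prod Inl Inl ` parcs G1 \<union> map_prod Inr Inr ` parcs G2 \<rparr>"

definition copies :: "nat \<Rightarrow> 'a pair_pre_digraph \<Rightarrow> (nat \<times> 'a) pair_pre_digraph" where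
  "copies s G = \<lparr> pverts = {0..<s} \<times> pverts G,
     parcs = {((i, u), (i, v)) | i u v. i < s \<and> (u, v) \<in> parcs G} \<rparr>"

lemma pair_graph_path_graph: "pair_graph (path_graph a)"
proof -
  have "parcs (path_graph a) \<subseteq> {0..<a} \<times> {0..<a}"
    by (auto simp: path_graph_def)
  then have "finite (parcs (path_graph a))"
    by (rule finite_subset) simp
  then show ?thesis
    by unfold_locales (auto simp: path_graph_def symmetric_def sym_def)
qed

lemma pair_graph_disjoint_union:
  assumes "pair_graph G1" "pair_graph G2"
  shows "pair_graph (disjoint_union G1 G2)"
proof -
  interpret G1: pair_graph G1 by fact
  interpret G2: pair_graph G2 by fact
  show ?thesis
    by unfold_locales
      (auto simp: disjoint_union_def symmetric_def intro!: symI
         dest: G1.in_arcsD1 G1.in_arcsD2 G2.in_arcsD1 G2.in_arcsD2 G1.no_loops' G2.no_loops'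
           G1.arcs_symmetric G2.arcs_symmetric)
qed

lemma pair_graph_copies:
  assumes "pair_graph G"
  shows "pair_graph (copies s G)"
proof -
  interpret G: pair_graph G by fact
  have "parcs (copies s G) \<subseteq> (\<lambda>(i, u, v). ((i, u), (i, v))) ` ({0..<s} \<times> parcs G)"
    by (force simp: copies_def)
  then have "finite (parcs (copies s G))"
    by (rule finite_subset) auto
  then show ?thesis
    by unfold_locales
      (auto simp: copies_def symmetric_def intro!: symI
         dest: G.in_arcsD1 G.in_arcsD2 G.no_loops' G.arcs_symmetric)
qed

definition induced_free :: "('a, 'b) pre_digraph \<Rightarrow> ('c, 'd) pre_digraph \<Rightarrow> bool" where
  "induced_free H G \<longleftrightarrow> \<not> (\<exists>K. induced_subgraph K G \<and> digraph_iso K H)"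

definition delete_verts :: "('a, 'b) pre_digraph \<Rightarrow> 'a set \<Rightarrow> ('a, 'b) pre_digraph" where
  "delete_verts G X = G \<restriction> (verts G - X)"

text \<open>
  With unit weights, \<open>\<mu>\<close> is the shortest-path distance; it is \<open>\<infinity>\<close> between vertices that are
  not joined by a walk, so a disconnected graph has diameter \<open>\<infinity>\<close>.
\<close>

definition diameter :: "('a, 'b) pre_digraph \<Rightarrow> ereal" where
  "diameter G = Max ((\<lambda>(s, t). wf_digraph.\<mu> G (\<lambda>_. 1) s t) ` (verts G \<times> verts G))"


text \<open>
  An adjacency-list stream lists every vertex exactly once, in arbitrary order, together with
  all its neighbours, again in arbitrary order.
\<close>

type_synonym al_token = "nat \<times> nat list"

definition al_stream :: "nat pair_pre_digraph \<Rightarrow> al_token list \<Rightarrow> bool" where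
  "al_stream G \<sigma> \<longleftrightarrow> distinct (map fst \<sigma>) \<and> set (map fst \<sigma>) = pverts G \<and>
     (\<forall>(v, ns) \<in> set \<sigma>. distinct ns \<and> set ns = {w. (v, w) \<in> parcs G})"

text \<open>
  The memory content is a bit string. Computation is unrestricted, so the transition and output
  maps are arbitrary functions. The first argument of \<open>alg_step\<close> is the number of the current
  pass. Memory is measured between tokens: an algorithm that processes the incident edges one
  at a time and is charged for its memory in between induces one of this kind that uses no more.
\<close>

record stream_alg =
  alg_init :: "bool list"
  alg_step :: "nat \<Rightarrow> bool list \<Rightarrow> al_token \<Rightarrow> bool list"
  alg_output :: "bool list \<Rightarrow> ereal"

definition passes :: "nat \<Rightarrow> al_token list \<Rightarrow> (nat \<times> al_token) list" where
  "passes p \<sigma> = concat (map (\<lambda>i. map (Pair i) \<sigma>) [0..<p])"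

definition memory_after :: "stream_alg \<Rightarrow> (nat \<times> al_token) list \<Rightarrow> bool list" where
  "memory_after A \<tau> = foldl (\<lambda>m (i, t). alg_step A i m t) (alg_init A) \<tau>"

definition alg_result :: "stream_alg \<Rightarrow> nat \<Rightarrow> al_token list \<Rightarrow> ereal" where
  "alg_result A p \<sigma> = alg_output A (memory_after A (passes p \<sigma>))"

definition bits_used :: "stream_alg \<Rightarrow> nat \<Rightarrow> al_token list \<Rightarrow> nat" where
  "bits_used A p \<sigma> =
     Max ((\<lambda>j. length (memory_after A (take j (passes p \<sigma>)))) ` {0..length (passes p \<sigma>)})"

text \<open>
  An instance is a graph \<open>G\<close> together with a vertex set \<open>X\<close>. The algorithm is given \<open>X\<close> for
  free, by being a family indexed by \<open>X\<close>; only \<open>G\<close> has to be read from the stream.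
\<close>

type_synonym diam_instance = "nat pair_pre_digraph \<times> nat set"

definition solves_diameter ::
  "nat \<Rightarrow> diam_instance set \<Rightarrow> (nat set \<Rightarrow> stream_alg) \<Rightarrow> bool" where
  "solves_diameter p \<C> A \<longleftrightarrow>
     (\<forall>(G, X) \<in> \<C>. \<forall>\<sigma>. al_stream G \<sigma> \<longrightarrow> alg_result (A X) p \<sigma> = diameter G)"

text \<open>
  \<open>\<C> n\<close> is the class of instances on \<open>n\<close> vertices. The constant \<open>c\<close> is uniform in \<open>n\<close>, \<open>p\<close>
  and the algorithm, which may depend on \<open>n\<close> and \<open>p\<close>.
\<close>

definition diameter_needs_bits ::
  "(nat \<Rightarrow> diam_instance set) \<Rightarrow> (nat \<Rightarrow> nat \<Rightarrow> real) \<Rightarrow> bool" where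
  "diameter_needs_bits \<C> f \<longleftrightarrow>
     (\<exists>c > 0. \<exists>N. \<forall>n \<ge> N. \<forall>p \<ge> 1. \<forall>A. solves_diameter p (\<C> n) A \<longrightarrow>
        (\<exists>(G, X) \<in> \<C> n. \<exists>\<sigma>. al_stream G \<sigma> \<and> c * f n p \<le> real (bits_used (A X) p \<sigma>)))"

definition free_deletion_instances ::
  "'h pair_pre_digraph \<Rightarrow> nat \<Rightarrow> nat \<Rightarrow> diam_instance set" where
  "free_deletion_instances H k n =
     {(G, X). pair_graph G \<and> pverts G = {0..<n} \<and> X \<subseteq> pverts G \<and> card X \<le> k \<and>
        induced_free (with_proj H) (delete_verts (with_proj G) X)}"

definition connected_free_deletion_instances ::
  "'h pair_pre_digraph \<Rightarrow> nat \<Rightarrow> nat \<Rightarrow> diam_instance set" where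
  "connected_free_deletion_instances H k n =
     {(G, X) \<in> free_deletion_instances H k n. connected (delete_verts (with_proj G) X)}"

end

theory Submission
  imports Defs
begin

text \<open>
  Disjointness of two sets \<open>S\<close> and \<open>T\<close> of about \<open>n / 2\<close> indices is encoded into a graph on \<open>n\<close>
  vertices whose diameter is at most 2 iff \<open>S \<inter> T = {}\<close>, and in which the neighbour list of each
  vertex depends on only one of the two sets. The instances with \<open>T\<close> the complement of \<open>S\<close> form a
  fooling set: if two of them led to the same memory contents at the two hand-over points of every
  pass, their halves could be exchanged without changing the output. Hence \<open>2 ^ (4 p b)\<close>, a bound
  on the number of such sequences of memory contents with at most \<open>b\<close> bits each, is at least the
  number \<open>2 ^ m\<close> of sets.

  All the information is carried by edges at the four deleted vertices, so what remains after the
  deletion is fixed: a perfect matching plus a hub, where either side of the matching may be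
  turned into a clique. With two cliques it has no independent triple; with one
  clique it is a split graph and has no induced \<open>2P\<^sub>2\<close>; with none it is a subdivided star, which has
  no triangle, or a friendship graph, which has no induced \<open>P\<^sub>4\<close> or \<open>C\<^sub>4\<close>. By a small Ramsey argument,
  \<open>H\<close> contains one of these patterns unless it is excluded or \<open>P\<^sub>3\<close>. For \<open>P\<^sub>3\<close> the hub is deleted as
  well, which leaves a disconnected matching.
\<close>

section \<open>Cut and paste for multi-pass algorithms\<close>

lemma passes_Suc: "passes (Suc k) \<sigma> = passes k \<sigma> @ map (Pair k) \<sigma>"
  by (simp add: passes_def)

lemma passes_le: "k \<le> p \<Longrightarrow> \<exists>ys. passes p \<sigma> = passes k \<sigma> @ ys"
proof (induction p)
  case 0
  then show ?case by simp
next
  case (Suc p)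
  then show ?case
    by (cases "k = Suc p") (auto simp: passes_Suc)
qed

lemma memory_after_append:
  "memory_after A (xs @ ys) = foldl (\<lambda>m (i, t). alg_step A i m t) (memory_after A xs) ys"
  by (simp add: memory_after_def)

lemma length_memory_after_le:
  assumes "passes p \<sigma> = xs @ ys"
  shows "length (memory_after A xs) \<le> bits_used A p \<sigma>"
proof -
  have "xs = take (length xs) (passes p \<sigma>)" "length xs \<le> length (passes p \<sigma>)"
    using assms by simp_all
  then show ?thesis
    unfolding bits_used_def by (intro Max_ge) (auto intro: rev_image_eqI)
qed

text \<open>The transcript of a two-party protocol: in every pass the owner of
  \<open>\<sigma>\<close> hands the memory over to the owner of \<open>\<tau>\<close>, who hands it
  back.\<close>

definition trace :: "stream_alg \<Rightarrow> nat \<Rightarrow> al_token list \<Rightarrow> al_token list \<Rightarrow>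
    (bool list \<times> bool list) list" where
  "trace A p \<sigma> \<tau> = map (\<lambda>k. (memory_after A (passes k (\<sigma> @ \<tau>) @ map (Pair k) \<sigma>),
     memory_after A (passes (Suc k) (\<sigma> @ \<tau>)))) [0..<p]"

text \<open>Half a pass depends only on its own half of the stream and on the memory at its start.
  By induction on the passes, equal traces thus keep the crossed run in step with both pure
  runs.\<close>

lemma memory_after_cut_paste:
  assumes "trace A p \<sigma> \<tau> = trace A p \<sigma>' \<tau>'" and "k \<le> p"
  shows "memory_after A (passes k (\<sigma> @ \<tau>')) = memory_after A (passes k (\<sigma> @ \<tau>)) \<and>
    memory_after A (passes k (\<sigma>' @ \<tau>')) = memory_after A (passes k (\<sigma> @ \<tau>))"
  using assms(2)
proof (induction k)
  case 0
  then show ?case by (simp add: passes_def)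
next
  case (Suc k)
  have mid: "memory_after A (passes k (\<sigma> @ \<tau>) @ map (Pair k) \<sigma>) =
      memory_after A (passes k (\<sigma>' @ \<tau>') @ map (Pair k) \<sigma>')"
    and fin: "memory_after A (passes (Suc k) (\<sigma> @ \<tau>)) = memory_after A (passes (Suc k) (\<sigma>' @ \<tau>'))"
    using assms(1) Suc.prems by (auto simp: trace_def)
  have "memory_after A (passes k (\<sigma> @ \<tau>') @ map (Pair k) \<sigma>) =
      memory_after A (passes k (\<sigma>' @ \<tau>') @ map (Pair k) \<sigma>')"
    using Suc mid by (simp add: memory_after_append)
  then have "memory_after A (passes (Suc k) (\<sigma> @ \<tau>')) = memory_after A (passes (Suc k) (\<sigma>' @ \<tau>'))"
    by (simp add: passes_Suc memory_after_append)
  with fin show ?case by simp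
qed

text \<open>The bound is chosen to be \<open>1\<close> for \<open>b = 0\<close>, so that no additive constant appears later.\<close>

lemma card_bool_lists_length_le: "card {w :: bool list. length w \<le> b} \<le> 2 ^ (2 * b)"
proof -
  have "card {w :: bool list. length w \<le> b} = (\<Sum>i\<le>b. 2 ^ i)"
    using card_lists_length_le[of "UNIV :: bool set" b] by simp
  moreover have "(\<Sum>i\<le>b. (2::nat) ^ i) \<le> 2 ^ (2 * b)"
  proof (induction b)
    case (Suc b)
    have "(2::nat) ^ b \<le> 2 ^ (2 * b)"
      by (rule power_increasing) auto
    with Suc show ?case
      by (simp del: power_increasing_iff)
  qed simp
  ultimately show ?thesis by simp
qed

text \<open>Two indices with equal traces would give both crossed inputs the output of a pure one.
  So the trace is injective on \<open>I\<close>, and it remains to count traces.\<close>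

lemma fooling_set_bound:
  assumes yes: "\<And>i. i \<in> I \<Longrightarrow> P (alg_result A p (\<sigma> i @ \<tau> i))"
    and no: "\<And>i j. i \<in> I \<Longrightarrow> j \<in> I \<Longrightarrow> i \<noteq> j \<Longrightarrow>
      \<not> P (alg_result A p (\<sigma> i @ \<tau> j)) \<or> \<not> P (alg_result A p (\<sigma> j @ \<tau> i))"
    and bits: "\<And>i. i \<in> I \<Longrightarrow> bits_used A p (\<sigma> i @ \<tau> i) \<le> b"
  shows "card I \<le> 2 ^ (4 * p * b)"
proof -
  let ?W = "{w :: bool list. length w \<le> b}"
  let ?T = "{xs. set xs \<subseteq> ?W \<times> ?W \<and> length xs = p}"
  let ?tr = "\<lambda>i. trace A p (\<sigma> i) (\<tau> i)"
  have finW: "finite ?W"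
    using finite_lists_length_le[of "UNIV :: bool set" b] by simp
  have "inj_on ?tr I"
  proof (rule inj_onI, rule ccontr)
    fix i j assume ij: "i \<in> I" "j \<in> I" "?tr i = ?tr j" "i \<noteq> j"
    have "alg_result A p (\<sigma> i @ \<tau> j) = alg_result A p (\<sigma> i @ \<tau> i)"
      "alg_result A p (\<sigma> j @ \<tau> i) = alg_result A p (\<sigma> j @ \<tau> j)"
      using memory_after_cut_paste[OF ij(3), of p] memory_after_cut_paste[OF ij(3)[symmetric], of p]
      by (simp_all add: alg_result_def)
    with yes no ij show False by metis
  qed
  moreover have "?tr ` I \<subseteq> ?T"
  proof -
    have "length (memory_after A (passes k (\<sigma> i @ \<tau> i) @ map (Pair k) (\<sigma> i))) \<le> b"
      "length (memory_after A (passes (Suc k) (\<sigma> i @ \<tau> i))) \<le> b" if "i \<in> I" "k < p" for i k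
    proof -
      obtain ys where ys: "passes p (\<sigma> i @ \<tau> i) = passes (Suc k) (\<sigma> i @ \<tau> i) @ ys"
        using passes_le[of "Suc k" p] \<open>k < p\<close> by auto
      from length_memory_after_le[OF this] bits[OF \<open>i \<in> I\<close>]
      show "length (memory_after A (passes (Suc k) (\<sigma> i @ \<tau> i))) \<le> b"
        using le_trans by blast
      have "passes p (\<sigma> i @ \<tau> i) =
          (passes k (\<sigma> i @ \<tau> i) @ map (Pair k) (\<sigma> i)) @ map (Pair k) (\<tau> i) @ ys"
        using ys by (simp add: passes_Suc)
      from length_memory_after_le[OF this] bits[OF \<open>i \<in> I\<close>]
      show "length (memory_after A (passes k (\<sigma> i @ \<tau> i) @ map (Pair k) (\<sigma> i))) \<le> b"
        using le_trans by blast
    qed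
    then show ?thesis by (auto simp: trace_def)
  qed
  moreover have "finite ?T"
    using finW by (intro finite_lists_length_eq finite_cartesian_product)
  ultimately have "card I \<le> card ?T"
    by (rule card_inj_on_le)
  also have "\<dots> = (card ?W * card ?W) ^ p"
    using finW by (simp add: card_lists_length_eq card_cartesian_product)
  \<comment> \<open>Two hand-over points per pass, each with at most \<open>2 ^ (2 * b)\<close>
    possible contents.\<close>
  also have "\<dots> \<le> (2 ^ (2 * b) * 2 ^ (2 * b)) ^ p"
    by (intro power_mono mult_mono card_bool_lists_length_le) auto
  also have "\<dots> = 2 ^ (4 * p * b)"
    by (simp add: power_add[symmetric] power_mult[symmetric] algebra_simps)
  finally show ?thesis .
qed

section \<open>Embeddings and distances\<close>

text \<open>The isomorphism acts separately on vertices and arcs and leads from the induced subgraph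
  to \<open>H\<close>; its inverse on vertices is a plain embedding of \<open>H\<close>, which is
  easier to refute.\<close>

lemma embedding_if_not_induced_free:
  assumes "pair_graph H"
    and "\<not> induced_free (with_proj H) (delete_verts (with_proj G) X)"
  obtains f where "inj_on f (pverts H)" and "f ` pverts H \<subseteq> pverts G - X"
    and "\<And>u v. u \<in> pverts H \<Longrightarrow> v \<in> pverts H \<Longrightarrow> (u, v) \<in> parcs H \<longleftrightarrow> (f u, f v) \<in> parcs G"
proof -
  obtain K h where K: "induced_subgraph K (delete_verts (with_proj G) X)"
    and h: "pre_digraph.digraph_isomorphism K h" "with_proj H = app_iso h K"
    using assms(2) unfolding induced_free_def digraph_iso_def by blast
  let ?g = "iso_verts h"
  define f where "f = the_inv_into (verts K) ?g"
  have VK: "verts K \<subseteq> pverts G - X"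
    and AK: "arcs K = {e \<in> parcs G. fst e \<in> verts K \<and> snd e \<in> verts K}"
    and tK: "tail K = fst" "head K = snd"
    using K unfolding induced_subgraph_def subgraph_def delete_verts_def compatible_def
    by (auto simp: induce_subgraph_def)
  have inj: "inj_on ?g (verts K)"
    and ends: "\<And>e. e \<in> arcs K \<Longrightarrow> ?g (fst e) = iso_tail h (iso_arcs h e) \<and> ?g (snd e) = iso_head h (iso_arcs h e)"
    using h(1) unfolding pre_digraph.digraph_isomorphism_def by (auto simp: tK)
  have VH: "pverts H = ?g ` verts K" and AH: "parcs H = iso_arcs h ` arcs K"
    and tH: "iso_tail h = fst" "iso_head h = snd"
    using h(2) by (auto simp: with_proj_def app_iso_def)
  \<comment> \<open>Tail and head are the two projections in both graphs, so \<open>?g\<close>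
    determines the action on arcs.\<close>
  have arc: "(?g x, ?g y) \<in> parcs H \<longleftrightarrow> (x, y) \<in> parcs G" if "x \<in> verts K" "y \<in> verts K" for x y
  proof
    assume "(?g x, ?g y) \<in> parcs H"
    then obtain e where e: "e \<in> arcs K" "iso_arcs h e = (?g x, ?g y)"
      unfolding AH by auto
    then have "?g (fst e) = ?g x" "?g (snd e) = ?g y"
      using ends tH by auto
    then have "fst e = x" "snd e = y"
      using inj that e(1) AK by (auto dest: inj_onD)
    then show "(x, y) \<in> parcs G"
      using e AK by (cases e) auto
  next
    assume "(x, y) \<in> parcs G"
    then have e: "(x, y) \<in> arcs K" using that AK by auto
    then have "iso_arcs h (x, y) = (?g x, ?g y)"
      using ends[OF e] tH by (simp add: prod_eq_iff)
    then show "(?g x, ?g y) \<in> parcs H"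
      using e AH by force
  qed
  show thesis
  proof
    show "inj_on f (pverts H)"
      unfolding f_def VH using inj by (rule inj_on_the_inv_into)
    have "f (?g x) = x" if "x \<in> verts K" for x
      unfolding f_def using inj that by (rule the_inv_into_f_f)
    then show "f ` pverts H \<subseteq> pverts G - X"
      and "\<And>u v. u \<in> pverts H \<Longrightarrow> v \<in> pverts H \<Longrightarrow> (u, v) \<in> parcs H \<longleftrightarrow> (f u, f v) \<in> parcs G"
      using VH VK arc by auto
  qed
qed

lemma digraph_isoI:
  assumes "pair_graph G" and "bij_betw f (pverts G) (pverts K)"
    and "parcs K \<subseteq> pverts K \<times> pverts K"
    and "\<And>u v. u \<in> pverts G \<Longrightarrow> v \<in> pverts G \<Longrightarrow> (u, v) \<in> parcs G \<longleftrightarrow> (f u, f v) \<in> parcs K"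
  shows "digraph_iso (with_proj G) (with_proj K)"
proof -
  interpret pair_graph G by fact
  let ?h = "\<lparr> iso_verts = f, iso_arcs = map_prod f f, iso_head = snd, iso_tail = fst \<rparr>"
  have sub: "parcs G \<subseteq> pverts G \<times> pverts G"
    by (auto dest: in_arcsD1 in_arcsD2)
  have inj: "inj_on f (pverts G)" and img: "f ` pverts G = pverts K"
    using assms(2) by (auto simp: bij_betw_def)
  have "inj_on (map_prod f f) (parcs G)"
    using map_prod_inj_on[OF inj inj] sub by (rule inj_on_subset)
  then have "digraph_isomorphism ?h"
    unfolding digraph_isomorphism_def using inj wf_digraph_axioms by auto
  moreover have "map_prod f f ` parcs G = parcs K"
  proof
    show "map_prod f f ` parcs G \<subseteq> parcs K"
      using sub assms(4) by fastforce
    show "parcs K \<subseteq> map_prod f f ` parcs G"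
    proof
      fix e assume "e \<in> parcs K"
      moreover from this obtain u v where "u \<in> pverts G" "v \<in> pverts G" "e = (f u, f v)"
        using assms(3) img by blast
      ultimately show "e \<in> map_prod f f ` parcs G"
        using assms(4) by force
    qed
  qed
  then have "with_proj K = app_iso ?h (with_proj G)"
    using img by (simp add: with_proj_def app_iso_def)
  ultimately show ?thesis
    unfolding digraph_iso_def by blast
qed

section \<open>Distance and diameter at most 2\<close>

lemma dist_le_2_iff:
  assumes "pair_graph G"
  shows "wf_digraph.\<mu> (with_proj G) (\<lambda>_. 1) u v \<le> 2 \<longleftrightarrow> u \<in> pverts G \<and> v \<in> pverts G \<and>
    (u = v \<or> (u, v) \<in> parcs G \<or> (\<exists>w. (u, w) \<in> parcs G \<and> (w, v) \<in> parcs G))"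
proof -
  interpret pair_graph G by fact
  have cost: "awalk_cost (\<lambda>_. 1) p = real (length p)" for p :: "('a \<times> 'a) list"
    by (induction p) auto
  show ?thesis
  proof
    assume "\<mu> (\<lambda>_. 1) u v \<le> 2"
    \<comment> \<open>The distance is an infimum over walks. Passing to the strict bound
      \<open>3\<close> yields an actual walk, whose integral length is then at most 2.\<close>
    also have "(2::ereal) < 3" by simp
    finally obtain p where p: "awalk u p v" "ereal (awalk_cost (\<lambda>_. 1) p) < 3"
      unfolding \<mu>_def by (auto simp: INF_less_iff)
    then have "length p < 3"
      unfolding cost by simp
    then have "length p = 0 \<or> length p = Suc 0 \<or> length p = Suc (Suc 0)"
      by arith
    then show "u \<in> pverts G \<and> v \<in> pverts G \<and>
        (u = v \<or> (u, v) \<in> parcs G \<or> (\<exists>w. (u, w) \<in> parcs G \<and> (w, v) \<in> parcs G))"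
      using p(1) by (auto simp: length_Suc_conv awalk_simps)
  next
    assume *: "u \<in> pverts G \<and> v \<in> pverts G \<and>
        (u = v \<or> (u, v) \<in> parcs G \<or> (\<exists>w. (u, w) \<in> parcs G \<and> (w, v) \<in> parcs G))"
    have "\<exists>p. awalk u p v \<and> length p \<le> 2"
    proof -
      consider "u = v" | "(u, v) \<in> parcs G" | w where "(u, w) \<in> parcs G" "(w, v) \<in> parcs G"
        using * by blast
      then show ?thesis
      proof cases
        case 1
        then show ?thesis using * by (intro exI[of _ "[]"]) (simp add: awalk_simps)
      next
        case 2
        then show ?thesis using * by (intro exI[of _ "[(u, v)]"]) (simp add: awalk_simps)
      next
        case (3 w)
        then show ?thesis
          using * by (intro exI[of _ "[(u, w), (w, v)]"]) (simp add: awalk_simps in_arcsD1)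
      qed
    qed
    then obtain p where "awalk u p v" "length p \<le> 2" by blast
    then show "\<mu> (\<lambda>_. 1) u v \<le> 2"
      using min_cost_le_walk_cost[of u p v "\<lambda>_. 1"] unfolding cost
      by (auto intro: order_trans)
  qed
qed

lemma diameter_le_2_iff:
  assumes "pair_graph G" "pverts G \<noteq> {}"
  shows "diameter (with_proj G) \<le> 2 \<longleftrightarrow> (\<forall>u \<in> pverts G. \<forall>v \<in> pverts G.
    u = v \<or> (u, v) \<in> parcs G \<or> (\<exists>w. (u, w) \<in> parcs G \<and> (w, v) \<in> parcs G))"
proof -
  interpret pair_graph G by fact
  have "diameter (with_proj G) \<le> 2 \<longleftrightarrow>
      (\<forall>u \<in> pverts G. \<forall>v \<in> pverts G. wf_digraph.\<mu> (with_proj G) (\<lambda>_. 1) u v \<le> 2)"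
    unfolding diameter_def using assms(2) pair_finite_verts
    by (subst Max_le_iff) auto
  then show ?thesis
    unfolding dist_le_2_iff[OF assms(1)] by blast
qed

section \<open>The gadget\<close>

text \<open>The switches do not affect the diameter criterion; they adapt what remains after the
  deletion to \<open>H\<close>. \<open>hub_even\<close> joins the hub to the even side too, which
  makes it adjacent to all that remains.\<close>

record shape =
  clique_odd :: bool
  clique_even :: bool
  hub_even :: bool

text \<open>
  The vertices \<open>0, 1, 2, 3\<close> form the deletion set, and \<open>4\<close> is a hub that keeps the rest connected.
  The rest consists of the pairs \<open>{2 i + 5, 2 i + 6}\<close>; the index \<open>i\<close> is \<open>idx\<close> of both members. For
  even \<open>n\<close> the last odd vertex has no partner, but its index lies outside \<open>S\<close>.
  Vertex \<open>3\<close> sees everything but \<open>1\<close>. An odd vertex reaches \<open>1\<close> in two steps only through \<open>0\<close>,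
  if its index is not in \<open>S\<close>, or through its partner, if its index is not in \<open>T\<close>.
\<close>

definition idx :: "nat \<Rightarrow> nat" where
  "idx u = (u - 5) div 2"

definition up_edge :: "shape \<Rightarrow> nat set \<Rightarrow> nat set \<Rightarrow> nat \<Rightarrow> nat \<Rightarrow> bool" where
  "up_edge R S T u v \<longleftrightarrow> u < v \<and>
     (if u = 0 then v \<in> {1, 3, 4} \<or> 5 \<le> v \<and> odd v \<and> idx v \<notin> S
      else if u = 1 then v = 2 \<or> 5 \<le> v \<and> even v \<and> idx v \<notin> T
      else if u = 2 then v \<in> {3, 4} \<or> 5 \<le> v \<and> even v
      else if u = 3 then True
      else if u = 4 then odd v \<or> hub_even R
      else odd u \<and> odd v \<and> clique_odd R \<or> even u \<and> even v \<and> clique_even R \<or> idx u = idx v)"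

definition edge :: "shape \<Rightarrow> nat set \<Rightarrow> nat set \<Rightarrow> nat \<Rightarrow> nat \<Rightarrow> bool" where
  "edge R S T u v \<longleftrightarrow> up_edge R S T u v \<or> up_edge R S T v u"

definition gadget :: "shape \<Rightarrow> nat \<Rightarrow> nat set \<Rightarrow> nat set \<Rightarrow> nat pair_pre_digraph" where
  "gadget R n S T = \<lparr> pverts = {0..<n}, parcs = {(u, v). u < n \<and> v < n \<and> edge R S T u v} \<rparr>"

lemma gadget_simps [simp]:
  "pverts (gadget R n S T) = {0..<n}"
  "(u, v) \<in> parcs (gadget R n S T) \<longleftrightarrow> u < n \<and> v < n \<and> edge R S T u v"
  by (simp_all add: gadget_def)

lemma pair_graph_gadget: "pair_graph (gadget R n S T)"
proof -
  have "parcs (gadget R n S T) \<subseteq> {0..<n} \<times> {0..<n}"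
    by auto
  then have "finite (parcs (gadget R n S T))"
    by (rule finite_subset) simp
  then show ?thesis
    by unfold_locales (auto simp: edge_def up_edge_def symmetric_def sym_def gadget_def)
qed

section \<open>Adjacency and distances in the gadget\<close>

lemma edge_commute: "edge R S T u v \<longleftrightarrow> edge R S T v u"
  by (auto simp: edge_def)

lemma idx_eq_iff:
  assumes "5 \<le> u" "5 \<le> v" "odd u" "even v"
  shows "idx u = idx v \<longleftrightarrow> v = Suc u"
proof -
  obtain k where k: "u = 2 * k + 1" using assms(3) by (elim oddE)
  obtain l where l: "v = 2 * l" using assms(4) by (elim evenE)
  have "idx u = k - 2" "idx v = l - 3"
    using assms unfolding k l idx_def by presburger+
  then show ?thesis
    using assms k l by auto
qed

lemma edge_odd_even:
  assumes "5 \<le> u" "5 \<le> v" "odd u" "even v"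
  shows "edge R S T u v \<longleftrightarrow> v = Suc u" "edge R S T v u \<longleftrightarrow> v = Suc u"
  using assms idx_eq_iff[OF assms]
  by (auto simp: edge_def up_edge_def)

lemma edge_odd_odd:
  assumes "5 \<le> u" "5 \<le> v" "odd u" "odd v"
  shows "edge R S T u v \<longleftrightarrow> clique_odd R \<and> u \<noteq> v"
proof -
  obtain k where k: "u = 2 * k + 1" using assms(3) by (elim oddE)
  obtain l where l: "v = 2 * l + 1" using assms(4) by (elim oddE)
  have "idx u = k - 2" "idx v = l - 2" "2 \<le> k" "2 \<le> l"
    using assms unfolding k l idx_def by presburger+
  then show ?thesis
    using assms unfolding k l by (auto simp: edge_def up_edge_def)
qed

lemma edge_even_even:
  assumes "5 \<le> u" "5 \<le> v" "even u" "even v"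
  shows "edge R S T u v \<longleftrightarrow> clique_even R \<and> u \<noteq> v"
proof -
  obtain k where k: "u = 2 * k" using assms(3) by (elim evenE)
  obtain l where l: "v = 2 * l" using assms(4) by (elim evenE)
  have "idx u = k - 3" "idx v = l - 3" "3 \<le> k" "3 \<le> l"
    using assms unfolding k l idx_def by presburger+
  then show ?thesis
    using assms unfolding k l by (auto simp: edge_def up_edge_def)
qed

lemma edge_4:
  assumes "5 \<le> v"
  shows "edge R S T 4 v \<longleftrightarrow> odd v \<or> hub_even R" "edge R S T v 4 \<longleftrightarrow> odd v \<or> hub_even R"
  using assms by (auto simp: edge_def up_edge_def)

lemma not_edge_refl: "\<not> edge R S T v v"
  by (simp add: edge_def up_edge_def)

lemma edge_3: "v \<noteq> 1 \<Longrightarrow> v \<noteq> 3 \<Longrightarrow> edge R S T 3 v \<and> edge R S T v 3"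
  by (auto simp: edge_def up_edge_def)

lemma edge_1: "edge R S T 1 v \<longleftrightarrow> v = 0 \<or> v = 2 \<or> 5 \<le> v \<and> even v \<and> idx v \<notin> T"
  by (cases "v = 0") (auto simp: edge_def up_edge_def)

lemma edge_0: "5 \<le> v \<Longrightarrow> odd v \<Longrightarrow> edge R S T 0 v \<longleftrightarrow> idx v \<notin> S"
  by (auto simp: edge_def up_edge_def)

text \<open>The neighbours \<open>0\<close> and \<open>2\<close> of \<open>1\<close> serve as
  midpoints whatever the sets are: \<open>0\<close> for \<open>3\<close> and \<open>4\<close>, and
  \<open>2\<close> for the even vertices from 6 on.\<close>

lemma dist_to_1:
  assumes "4 < n" "v < n" "v \<noteq> 1" "\<not> (5 \<le> v \<and> odd v)"
  shows "\<exists>w < n. edge R S T 1 w \<and> edge R S T w v \<or> edge R S T 1 v"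
proof -
  have "v = 0 \<or> v = 2 \<or> (v = 3 \<or> v = 4) \<or> 5 \<le> v \<and> even v"
    using assms by auto
  moreover have "edge R S T 1 0" "edge R S T 1 2"
    by (simp_all add: edge_def up_edge_def)
  moreover have "edge R S T 0 v" if "v = 3 \<or> v = 4"
    using that by (auto simp: edge_def up_edge_def)
  moreover have "edge R S T 2 v" if "5 \<le> v" "even v"
    using that by (simp add: edge_def up_edge_def)
  moreover have "0 < n" "2 < n"
    using assms(1) by simp_all
  ultimately show ?thesis by blast
qed

text \<open>An odd vertex from 5 on misses \<open>2\<close>, and the only even vertex from 6 on that
  it sees is its partner, which leaves \<open>0\<close> and the partner as midpoints.
  \<open>Suc v < n\<close> accounts for a last odd vertex without partner.\<close>

lemma dist_odd_to_1:
  assumes "v < n" "5 \<le> v" "odd v"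
  shows "(\<exists>w < n. edge R S T v w \<and> edge R S T w 1) \<longleftrightarrow>
    idx v \<notin> S \<or> Suc v < n \<and> idx v \<notin> T"
proof -
  have "idx (Suc v) = idx v"
    using idx_eq_iff[of v "Suc v"] assms by simp
  moreover have "\<not> edge R S T v 2"
    using assms by (auto simp: edge_def up_edge_def)
  moreover have "edge R S T v 0 \<longleftrightarrow> idx v \<notin> S"
    using assms edge_0[of v] edge_commute[of R S T] by blast
  moreover have "edge R S T v w \<longleftrightarrow> w = Suc v" if "5 \<le> w" "even w" for w
    using edge_odd_even(1)[of v w] assms that by blast
  moreover have "5 \<le> Suc v" "even (Suc v)" "0 < n"
    using assms by simp_all
  ultimately show ?thesis
    unfolding edge_commute[of R S T _ 1] edge_1 by metis
qed

text \<open>Vertex \<open>3\<close> connects any two vertices other than \<open>1\<close>, so by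
  \<open>dist_to_1\<close> only \<open>1\<close> and an odd vertex from 5 on can be far apart. The
  indices below \<open>(n - 5) div 2\<close> are those of complete pairs.\<close>

lemma diameter_gadget_le_2_iff:
  assumes n: "5 < n" and ST: "S \<subseteq> {..<(n - 5) div 2}" "T \<subseteq> {..<(n - 5) div 2}"
  shows "diameter (with_proj (gadget R n S T)) \<le> 2 \<longleftrightarrow> S \<inter> T = {}"
proof -
  let ?close = "\<lambda>u v. u = v \<or> edge R S T u v \<or> (\<exists>w < n. edge R S T u w \<and> edge R S T w v)"
  have sym: "?close u v \<longleftrightarrow> ?close v u" for u v
    using edge_commute[of R S T] by blast
  have far: "?close u v" if "u < n" "v < n" "u \<noteq> 1" "v \<noteq> 1" for u v
  proof (cases "u = 3 \<or> v = 3")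
    case True
    then show ?thesis using edge_3[of u R S T] edge_3[of v R S T] that by blast
  next
    case False
    then have "edge R S T u 3" "edge R S T 3 v" "3 < n"
      using edge_3[of u R S T] edge_3[of v R S T] that n by simp_all
    then show ?thesis by blast
  qed
  have one: "?close 1 v" if "v < n" "\<not> (5 \<le> v \<and> odd v)" for v
    using dist_to_1[of n v R S T] that n by (cases "v = 1") auto
  have odd: "?close v 1 \<longleftrightarrow> idx v \<notin> S \<or> Suc v < n \<and> idx v \<notin> T" if "v < n" "5 \<le> v" "odd v" for v
  proof -
    have "\<not> edge R S T v 1" "v \<noteq> 1"
      unfolding edge_commute[of R S T v 1] edge_1 using that by auto
    then show ?thesis
      using dist_odd_to_1[OF that, of R S T] by blast
  qed
  have "diameter (with_proj (gadget R n S T)) \<le> 2 \<longleftrightarrow> (\<forall>u<n. \<forall>v<n. ?close u v)"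
  proof -
    let ?A = "parcs (gadget R n S T)"
    have "(u = v \<or> (u, v) \<in> ?A \<or> (\<exists>w. (u, w) \<in> ?A \<and> (w, v) \<in> ?A)) \<longleftrightarrow> ?close u v"
      if "u < n" "v < n" for u v
      using that by (simp add: conj_ac)
    moreover have "pverts (gadget R n S T) \<noteq> {}" using n by simp
    ultimately show ?thesis
      using diameter_le_2_iff[OF pair_graph_gadget, of R n S T]
      by (simp del: gadget_simps(2) add: Ball_def)
  qed
  also have "\<dots> \<longleftrightarrow> (\<forall>v<n. 5 \<le> v \<and> odd v \<longrightarrow> ?close v 1)"
  proof (intro iffI allI impI)
    fix v assume "\<forall>u<n. \<forall>v<n. ?close u v" "v < n"
    moreover have "1 < n" using n by simp
    ultimately show "?close v 1" by blast
  next
    fix u v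
    assume *: "\<forall>v<n. 5 \<le> v \<and> odd v \<longrightarrow> ?close v 1" and uv: "u < n" "v < n"
    have 1: "?close 1 v" if "v < n" for v
      using one[OF that] * that sym[of 1 v] by blast
    show "?close u v"
    proof (cases "u = 1 \<or> v = 1")
      case True
      then show ?thesis using 1[OF uv(1)] 1[OF uv(2)] sym[of 1 u] by blast
    next
      case False
      then show ?thesis using far[OF uv] by blast
    qed
  qed
  also have "\<dots> \<longleftrightarrow> (\<forall>v<n. 5 \<le> v \<and> odd v \<longrightarrow> idx v \<notin> S \<or> Suc v < n \<and> idx v \<notin> T)"
    using odd by blast
  also have "\<dots> \<longleftrightarrow> S \<inter> T = {}"
  proof safe
    fix i
    assume *: "\<forall>v<n. 5 \<le> v \<and> odd v \<longrightarrow> idx v \<notin> S \<or> Suc v < n \<and> idx v \<notin> T" "i \<in> S" "i \<in> T"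
    have "2 * i + 5 < n"
      using ST(1) \<open>i \<in> S\<close> by fastforce
    then show "i \<in> {}"
      using *(1)[rule_format, of "2 * i + 5"] * by (simp add: idx_def)
  next
    fix v
    assume *: "S \<inter> T = {}" "v < n" "5 \<le> v" "odd v" "idx v \<in> S"
    \<comment> \<open>An index in \<open>S\<close> belongs to a complete pair, so the partner of
      \<open>v\<close> exists.\<close>
    then have "idx v < (n - 5) div 2"
      using ST by auto
    then show "Suc v < n"
      using *(3,4) unfolding idx_def by presburger
    show False if "idx v \<in> T"
      using * that by auto
  qed
  finally show ?thesis .
qed

text \<open>
  \<open>S\<close> only affects the edges between \<open>0\<close> and odd vertices, and \<open>T\<close> only those between \<open>1\<close> and
  even vertices. So no neighbour list depends on both sets, and the stream splits into a part
  known to the owner of \<open>S\<close> and a part known to the owner of \<open>T\<close>.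
\<close>

definition owned_by_T :: "nat \<Rightarrow> bool" where
  "owned_by_T v \<longleftrightarrow> v \<in> {1, 2} \<or> 5 \<le> v \<and> even v"

definition token :: "shape \<Rightarrow> nat \<Rightarrow> nat set \<Rightarrow> nat set \<Rightarrow> nat \<Rightarrow> al_token" where
  "token R n S T v = (v, filter (edge R S T v) [0..<n])"

text \<open>The set \<open>{}\<close> is a placeholder for the \<open>T\<close> unknown to this
  party.\<close>

definition stream_S :: "shape \<Rightarrow> nat \<Rightarrow> nat set \<Rightarrow> al_token list" where
  "stream_S R n S = map (token R n S {}) (filter (\<lambda>v. \<not> owned_by_T v) [0..<n])"

definition stream_T :: "shape \<Rightarrow> nat \<Rightarrow> nat set \<Rightarrow> al_token list" where
  "stream_T R n T = map (token R n {} T) (filter owned_by_T [0..<n])"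

lemma token_owned_by_T: "owned_by_T v \<Longrightarrow> token R n {} T v = token R n S T v"
proof -
  assume v: "owned_by_T v"
  have "up_edge R {} T u w = up_edge R S T u w" if "u \<noteq> 0 \<or> even w \<or> w < 5" for u w
    using that by (auto simp: up_edge_def)
  moreover have "v \<noteq> 0" "even v \<or> v < 5"
    using v by (auto simp: owned_by_T_def)
  ultimately have "edge R {} T v = edge R S T v"
    unfolding edge_def fun_eq_iff by blast
  then show ?thesis
    by (simp add: token_def)
qed

lemma token_not_owned_by_T: "\<not> owned_by_T v \<Longrightarrow> token R n S {} v = token R n S T v"
proof -
  assume v: "\<not> owned_by_T v"
  have "up_edge R S {} u w = up_edge R S T u w" if "u \<noteq> 1 \<or> odd w \<or> w < 5" for u w
    using that by (auto simp: up_edge_def)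
  moreover have "v \<noteq> 1" "odd v \<or> v < 5"
    using v by (auto simp: owned_by_T_def)
  ultimately have "edge R S {} v = edge R S T v"
    unfolding edge_def fun_eq_iff by blast
  then show ?thesis
    by (simp add: token_def)
qed

lemma al_stream_gadget: "al_stream (gadget R n S T) (stream_S R n S @ stream_T R n T)"
proof -
  have "stream_S R n S @ stream_T R n T =
      map (token R n S T) (filter (\<lambda>v. \<not> owned_by_T v) [0..<n] @ filter owned_by_T [0..<n])"
    by (simp add: stream_S_def stream_T_def token_owned_by_T token_not_owned_by_T)
  moreover have "fst \<circ> token R n S T = id"
    by (auto simp: token_def)
  ultimately show ?thesis
    unfolding al_stream_def by (auto simp: token_def)
qed

text \<open>As \<open>X\<close> is fixed, the single algorithm \<open>A X\<close> runs on all
  gadgets. Membership is assumed for all \<open>S\<close> and \<open>T\<close> because the crossed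
  inputs must be answered correctly too.\<close>

lemma diameter_needs_bits_gadget:
  assumes "\<And>n S T. 5 < n \<Longrightarrow> (gadget R n S T, X) \<in> \<C> n"
  shows "diameter_needs_bits \<C> (\<lambda>n p. real n / real p)"
  unfolding diameter_needs_bits_def
proof (intro exI conjI allI impI)
  \<comment> \<open>One factor 4 comes from the bound on traces, the other from
    \<open>n \<le> 4 * m\<close>, which holds from \<open>n = 12\<close> on.\<close>
  show "(1 / 16 :: real) > 0" by simp
next
  fix n p :: nat and A
  assume n: "12 \<le> n" and p: "1 \<le> p" and A: "solves_diameter p (\<C> n) A"
  define m where "m = (n - 5) div 2"
  define used where
    "used S = bits_used (A X) p (stream_S R n S @ stream_T R n ({..<m} - S))" for S
  define b where "b = Max (used ` Pow {..<m})"
  have res: "alg_result (A X) p (stream_S R n S @ stream_T R n T) \<le> 2 \<longleftrightarrow> S \<inter> T = {}"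
    if "S \<subseteq> {..<m}" "T \<subseteq> {..<m}" for S T
    using that n A assms[of n S T] al_stream_gadget[of R n S T] diameter_gadget_le_2_iff[of n S T R]
    unfolding solves_diameter_def m_def by fastforce
  have "card (Pow {..<m}) \<le> 2 ^ (4 * p * b)"
  proof (rule fooling_set_bound[where P = "\<lambda>d. d \<le> 2" and A = "A X" and \<sigma> = "stream_S R n"
        and \<tau> = "\<lambda>S. stream_T R n ({..<m} - S)"])
    fix S S' assume "S \<in> Pow {..<m}" "S' \<in> Pow {..<m}" "S \<noteq> S'"
    \<comment> \<open>An element of exactly one of the two sets makes one of the crossed inputs
      intersecting.\<close>
    then have "S \<inter> ({..<m} - S') \<noteq> {} \<or> S' \<inter> ({..<m} - S) \<noteq> {}"
      by blast
    then show "\<not> alg_result (A X) p (stream_S R n S @ stream_T R n ({..<m} - S')) \<le> 2 \<or>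
        \<not> alg_result (A X) p (stream_S R n S' @ stream_T R n ({..<m} - S)) \<le> 2"
      using \<open>S \<in> Pow {..<m}\<close> \<open>S' \<in> Pow {..<m}\<close> by (subst (1 2) res) auto
  next
    fix S assume "S \<in> Pow {..<m}"
    then show "bits_used (A X) p (stream_S R n S @ stream_T R n ({..<m} - S)) \<le> b"
      unfolding b_def used_def[symmetric] by (intro Max_ge) auto
  qed (subst res, auto)
  then have "m \<le> 4 * p * b"
    by (simp add: card_Pow)
  moreover have "n \<le> 4 * m"
    using n unfolding m_def by presburger
  ultimately have "n \<le> 16 * p * b" by simp
  then have "real n \<le> 16 * real p * real b"
    by (metis of_nat_le_iff of_nat_mult of_nat_numeral)
  then have "1 / 16 * (real n / real p) \<le> real b"
    using p by (simp add: field_simps)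
  moreover obtain S where "b = used S"
    unfolding b_def using Max_in[of "used ` Pow {..<m}"] by blast
  ultimately show "\<exists>(G, X) \<in> \<C> n. \<exists>\<sigma>. al_stream G \<sigma> \<and>
      1 / 16 * (real n / real p) \<le> real (bits_used (A X) p \<sigma>)"
    using assms[of n S "{..<m} - S"] n al_stream_gadget[of R n S "{..<m} - S"]
    unfolding used_def by (intro bexI[of _ "(gadget R n S ({..<m} - S), X)"]) auto
qed

section \<open>Avoiding an induced subgraph\<close>

text \<open>The upper bound \<open>n\<close> on the image is dropped, so that the embeddings to be
  refuted go into one infinite graph \<open>edge R S T\<close>. The budget 5 serves both
  \<open>k = 4\<close> and \<open>k = 5\<close>.\<close>

lemma gadget_free_deletion_instance:
  assumes "pair_graph H" "k \<le> 5" "5 < n"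
    and no_emb: "\<And>f. inj_on f (pverts H) \<Longrightarrow> \<forall>u \<in> pverts H. k \<le> f u \<Longrightarrow>
      \<forall>u \<in> pverts H. \<forall>v \<in> pverts H. (u, v) \<in> parcs H \<longleftrightarrow> edge R S T (f u) (f v) \<Longrightarrow> False"
  shows "(gadget R n S T, {0..<k}) \<in> free_deletion_instances H 5 n"
proof -
  have "induced_free (with_proj H) (delete_verts (with_proj (gadget R n S T)) {0..<k})"
  proof (rule ccontr)
    assume "\<not> ?thesis"
    then obtain f where f: "inj_on f (pverts H)" "f ` pverts H \<subseteq> {0..<n} - {0..<k}"
      "\<And>u v. u \<in> pverts H \<Longrightarrow> v \<in> pverts H \<Longrightarrow> (u, v) \<in> parcs H \<longleftrightarrow>
        (f u, f v) \<in> parcs (gadget R n S T)"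
      using embedding_if_not_induced_free[OF assms(1)] by (metis gadget_simps(1))
    have ge: "\<forall>u \<in> pverts H. k \<le> f u \<and> f u < n"
      using f(2) by fastforce
    show False
      by (rule no_emb[OF f(1)]) (use ge f(3) in auto)
  qed
  then show ?thesis
    using assms pair_graph_gadget[of R n S T] by (auto simp: free_deletion_instances_def)
qed

text \<open>In every shape the odd vertices see the hub \<open>4\<close>, and an even vertex
  \<open>v\<close> sees its partner \<open>v - 1\<close>, which is below \<open>n\<close> along with
  \<open>v\<close>.\<close>

lemma connected_gadget:
  assumes "5 < n"
  shows "connected (delete_verts (with_proj (gadget R n S T)) {0..<4})"
proof -
  let ?D = "delete_verts (with_proj (gadget R n S T)) {0..<4}"
  \<comment> \<open>Connectedness refers to the symmetric closure, which adds no arcs here since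
    \<open>edge\<close> is symmetric.\<close>
  let ?G = "mk_symmetric ?D"
  have D: "verts ?D = {4..<n}"
    by (auto simp: delete_verts_def induce_subgraph_def)
  then have V: "pverts ?G = {4..<n}"
    by (simp add: mk_symmetric_def)
  have E: "(u, v) \<in> parcs ?G \<longleftrightarrow> u \<in> {4..<n} \<and> v \<in> {4..<n} \<and> edge R S T u v" for u v
    using edge_commute[of R S T u v]
    by (force simp: mk_symmetric_def delete_verts_def induce_subgraph_def)
  interpret G: pair_wf_digraph ?G
    by unfold_locales (auto simp: E D V)
  have odd: "v \<rightarrow>\<^sup>*\<^bsub>with_proj ?G\<^esub> 4 \<and> 4 \<rightarrow>\<^sup>*\<^bsub>with_proj ?G\<^esub> v" if "5 \<le> v" "v < n" "odd v" for v
    using that assms by (auto intro!: G.reachable_adjI simp: E edge_4)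
  have "v \<rightarrow>\<^sup>*\<^bsub>with_proj ?G\<^esub> 4 \<and> 4 \<rightarrow>\<^sup>*\<^bsub>with_proj ?G\<^esub> v" if v: "4 \<le> v" "v < n" for v
  proof -
    consider "v = 4" | "5 \<le> v" "odd v" | "6 \<le> v" "even v"
    proof -
      have "v = 4 \<or> 5 \<le> v \<and> odd v \<or> 6 \<le> v \<and> even v"
        using v(1) by presburger
      then show thesis using that by blast
    qed
    then show ?thesis
    proof cases
      case 1
      then show ?thesis using assms V by auto
    next
      case 2
      then show ?thesis using odd v by blast
    next
      case 3
      define u where "u = v - 1"
      have u: "5 \<le> u" "u < n" "odd u" "v = Suc u"
        using 3 v by (auto simp: u_def)
      then have "edge R S T u v" "edge R S T v u"
        using edge_odd_even[of u v R S T] 3 by auto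
      then have "u \<rightarrow>\<^sup>*\<^bsub>with_proj ?G\<^esub> v" "v \<rightarrow>\<^sup>*\<^bsub>with_proj ?G\<^esub> u"
        using u v by (auto intro!: G.reachable_adjI simp: E)
      then show ?thesis
        using odd[OF u(1-3)] G.reachable_trans by blast
    qed
  qed
  then have "u \<rightarrow>\<^sup>*\<^bsub>with_proj ?G\<^esub> v" if "u \<in> pverts ?G" "v \<in> pverts ?G" for u v
    using that G.reachable_trans unfolding V by (meson atLeastLessThan_iff)
  then show ?thesis
    unfolding connected_def using assms by (intro strongly_connectedI) (auto simp: D V)
qed

section \<open>Patterns missing from each shape\<close>

lemma edge_ge_4_iff:
  assumes "4 \<le> u" "4 \<le> v"
  shows "edge R S T u v \<longleftrightarrow> u \<noteq> v \<and>
    (if u = 4 then odd v \<or> hub_even R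
     else if v = 4 then odd u \<or> hub_even R
     else if odd u \<and> odd v then clique_odd R
     else if even u \<and> even v then clique_even R
     else if odd u then v = Suc u
     else u = Suc v)"
proof -
  have "u = 4 \<or> 5 \<le> u" "v = 4 \<or> 5 \<le> v" using assms by auto
  then show ?thesis
    using edge_4[of v R S T] edge_4[of u R S T] not_edge_refl[of R S T u]
      edge_odd_odd[of u v R S T] edge_even_even[of u v R S T]
      edge_odd_even[of u v R S T] edge_odd_even[of v u R S T]
    by auto
qed

text \<open>The hub with the odd vertices is a clique, and so are the even vertices from 6 on; two
  of any three vertices share a clique.\<close>

lemma two_cliques_no_independent_triple:
  assumes R: "clique_odd R" "clique_even R" and ge: "4 \<le> x" "4 \<le> y" "4 \<le> z"
    and "x \<noteq> y" "x \<noteq> z" "y \<noteq> z"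
    and "\<not> edge R S T x y" "\<not> edge R S T x z" "\<not> edge R S T y z"
  shows False
proof -
  have "edge R S T u v" if "4 \<le> u" "4 \<le> v" "u \<noteq> v" "(u = 4 \<or> odd u) = (v = 4 \<or> odd v)" for u v
    using that R by (auto simp: edge_ge_4_iff)
  then show False
    using assms by metis
qed

text \<open>The graph is bipartite by parity: the hub \<open>4\<close> is even and sees only odd
  vertices, and so do the even members of the matching.\<close>

lemma spider_no_triangle:
  assumes R: "\<not> clique_odd R" "\<not> clique_even R" "\<not> hub_even R"
    and ge: "4 \<le> x" "4 \<le> y" "4 \<le> z"
    and "edge R S T x y" "edge R S T x z" "edge R S T y z"
  shows False
proof -
  have "odd u \<noteq> odd v" if "edge R S T u v" "4 \<le> u" "4 \<le> v" for u v
    using that R by (auto simp: edge_ge_4_iff split: if_splits)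
  then show False
    using assms by metis
qed

text \<open>The hub and the odd vertices form a clique and the other vertices are independent. So
  two disjoint edges each have an end in the clique, and these ends are adjacent.\<close>

lemma split_no_two_edges:
  assumes R: "clique_odd R" "\<not> clique_even R" "\<not> hub_even R"
    and ge: "4 \<le> a" "4 \<le> b" "4 \<le> c" "4 \<le> d"
    and "edge R S T a b" "edge R S T c d" "a \<noteq> c" "a \<noteq> d" "b \<noteq> c" "b \<noteq> d"
    and "\<not> edge R S T a c" "\<not> edge R S T a d" "\<not> edge R S T b c" "\<not> edge R S T b d"
  shows False
proof -
  let ?core = "\<lambda>u. u = 4 \<or> odd u"
  have "?core u \<or> ?core v" if "edge R S T u v" "4 \<le> u" "4 \<le> v" for u v
    using that R by (auto simp: edge_ge_4_iff split: if_splits)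
  then have "?core a \<or> ?core b" "?core c \<or> ?core d"
    using assms by blast+
  moreover have "edge R S T u v" if "?core u" "?core v" "u \<noteq> v" "4 \<le> u" "4 \<le> v" for u v
    using that R by (auto simp: edge_ge_4_iff)
  ultimately show False
    using assms by blast
qed

text \<open>From 5 on only the matching is left, so \<open>b\<close> has just one neighbour
  there.\<close>

lemma matching_no_path:
  assumes R: "\<not> clique_odd R" "\<not> clique_even R" and ge: "5 \<le> a" "5 \<le> b" "5 \<le> c"
    and "edge R S T a b" "edge R S T b c" "a \<noteq> c"
  shows False
proof -
  have "v = (if odd u then Suc u else u - 1)" if "edge R S T u v" "5 \<le> u" "5 \<le> v" for u v
    using that R by (auto simp: edge_ge_4_iff split: if_splits)
  moreover have "edge R S T b a"
    using assms edge_commute by blast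
  ultimately show False
    using assms by metis
qed

text \<open>The hub has no non-neighbours, so none of \<open>a\<close>, \<open>b\<close>,
  \<open>c\<close> is the hub, and away from it only the matching is left.\<close>

lemma friendship_no_path:
  assumes "\<not> clique_odd R" "\<not> clique_even R" "hub_even R"
    and ge: "4 \<le> a" "4 \<le> b" "4 \<le> c" "4 \<le> d"
    and "edge R S T a b" "edge R S T b c" "a \<noteq> c" "b \<noteq> d"
    and "\<not> edge R S T a c" "\<not> edge R S T b d"
  shows False
proof -
  have "edge R S T u v" if "u = 4 \<or> v = 4" "u \<noteq> v" "4 \<le> u" "4 \<le> v" for u v
    using that assms(3) by (auto simp: edge_ge_4_iff)
  then have "a \<noteq> 4" "b \<noteq> 4" "c \<noteq> 4"
    using assms by blast+
  with assms show False
    using matching_no_path[of R a b c S T] by simp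
qed

section \<open>Small graphs\<close>

lemma iso_single:
  assumes "pair_graph H" "pverts H = {x}"
  shows "digraph_iso (with_proj H) (with_proj (copies 1 (path_graph 1)))"
proof -
  interpret pair_graph H by fact
  have "parcs H = {}" using assms(2) in_arcsD1 in_arcsD2 no_loops' by fastforce
  then show ?thesis
    using assms
    by (intro digraph_isoI[where f = "\<lambda>_. (0, 0)"])
      (auto simp: copies_def path_graph_def bij_betw_def)
qed

lemma iso_two_isolated:
  assumes "pair_graph H" "pverts H = {x, y}" "x \<noteq> y" "(x, y) \<notin> parcs H"
  shows "digraph_iso (with_proj H) (with_proj (copies 2 (path_graph 1)))"
proof -
  interpret pair_graph H by fact
  have "parcs H = {}"
    using assms in_arcsD1 in_arcsD2 no_loops' arcs_symmetric by fastforce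
  then show ?thesis
    using assms
    by (intro digraph_isoI[where f = "\<lambda>v. if v = x then (0, 0) else (1, 0)"])
      (auto simp: copies_def path_graph_def bij_betw_def inj_on_def numeral_2_eq_2 less_Suc_eq)
qed

lemma iso_edge:
  assumes "pair_graph H" "pverts H = {x, y}" "(x, y) \<in> parcs H"
  shows "digraph_iso (with_proj H)
    (with_proj (disjoint_union (path_graph 2) (copies 0 (path_graph 1))))"
proof -
  interpret pair_graph H by fact
  have "x \<noteq> y" "(y, x) \<in> parcs H" "(x, x) \<notin> parcs H" "(y, y) \<notin> parcs H"
    using assms(3) no_loops' arcs_symmetric by blast+
  then show ?thesis
    using assms
    by (intro digraph_isoI[where f = "\<lambda>v. Inl (if v = x then 0 else 1)"])
      (auto simp: copies_def path_graph_def disjoint_union_def bij_betw_def inj_on_def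
        numeral_2_eq_2 less_Suc_eq)
qed

lemma iso_edge_isolated:
  assumes "pair_graph H" "pverts H = {x, y, z}" "(x, y) \<in> parcs H"
    and "z \<noteq> x" "z \<noteq> y" "(x, z) \<notin> parcs H" "(y, z) \<notin> parcs H"
  shows "digraph_iso (with_proj H)
    (with_proj (disjoint_union (path_graph 2) (copies 1 (path_graph 1))))"
proof -
  interpret pair_graph H by fact
  have "x \<noteq> y" "(y, x) \<in> parcs H" "(x, x) \<notin> parcs H" "(y, y) \<notin> parcs H" "(z, z) \<notin> parcs H"
    "(z, x) \<notin> parcs H" "(z, y) \<notin> parcs H"
    using assms(3,6,7) no_loops' arcs_symmetric by blast+
  then show ?thesis
    using assms
    by (intro digraph_isoI[where f = "\<lambda>v. if v = z then Inr (0, 0) else Inl (if v = x then 0 else 1)"])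
      (auto simp: copies_def path_graph_def disjoint_union_def bij_betw_def inj_on_def
        numeral_2_eq_2 less_Suc_eq)
qed

lemma iso_path_3:
  assumes "pair_graph H" "pverts H = {x, y, z}" "(x, y) \<in> parcs H" "(y, z) \<in> parcs H"
    and "x \<noteq> z" "(x, z) \<notin> parcs H"
  shows "digraph_iso (with_proj H) (with_proj (path_graph 3))"
proof -
  interpret pair_graph H by fact
  have "x \<noteq> y" "y \<noteq> z" "(y, x) \<in> parcs H" "(z, y) \<in> parcs H" "(z, x) \<notin> parcs H"
    "(x, x) \<notin> parcs H" "(y, y) \<notin> parcs H" "(z, z) \<notin> parcs H"
    using assms(3,4,6) no_loops' arcs_symmetric by blast+
  then show ?thesis
    using assms
    by (intro digraph_isoI[where f = "\<lambda>v. if v = x then 0 else if v = y then 1 else 2"])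
      (auto simp: path_graph_def bij_betw_def inj_on_def numeral_3_eq_3 numeral_2_eq_2 less_Suc_eq)
qed

text \<open>
  Without a triangle and an independent triple, every vertex has at most two neighbours and at
  most two non-neighbours.
\<close>

lemma small_graph_cases:
  assumes "pair_graph H" "pverts H \<noteq> {}"
  obtains
    (independent) x y z where "x \<in> pverts H" "y \<in> pverts H" "z \<in> pverts H"
      "x \<noteq> y" "x \<noteq> z" "y \<noteq> z" "(x, y) \<notin> parcs H" "(x, z) \<notin> parcs H" "(y, z) \<notin> parcs H"
  | (triangle) x y z where "(x, y) \<in> parcs H" "(x, z) \<in> parcs H" "(y, z) \<in> parcs H"
  | (two_edges) a b c d where "(a, b) \<in> parcs H" "(c, d) \<in> parcs H"
      "a \<noteq> c" "a \<noteq> d" "b \<noteq> c" "b \<noteq> d"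
      "(a, c) \<notin> parcs H" "(a, d) \<notin> parcs H" "(b, c) \<notin> parcs H" "(b, d) \<notin> parcs H"
  | (path_or_cycle) a b c d where "(a, b) \<in> parcs H" "(b, c) \<in> parcs H" "(c, d) \<in> parcs H"
      "a \<noteq> c" "b \<noteq> d" "(a, c) \<notin> parcs H" "(b, d) \<notin> parcs H"
  | (path_3) x y z where "pverts H = {x, y, z}" "(x, y) \<in> parcs H" "(y, z) \<in> parcs H"
      "x \<noteq> z" "(x, z) \<notin> parcs H"
  | (linear) s where "s \<in> {0, 1}" "digraph_iso (with_proj H)
      (with_proj (disjoint_union (path_graph 2) (copies s (path_graph 1))))"
  | (edgeless) s where "s \<in> {1, 2}"
      "digraph_iso (with_proj H) (with_proj (copies s (path_graph 1)))"
proof -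
  interpret pair_graph H by fact
  let ?E = "\<lambda>x y. (x, y) \<in> parcs H"
  obtain u where u: "u \<in> pverts H" using assms(2) by blast
  define N where "N = {v. ?E u v}"
  define M where "M = {v \<in> pverts H. v \<noteq> u \<and> \<not> ?E u v}"
  have V: "pverts H = insert u (N \<union> M)"
    using u by (auto simp: N_def M_def in_arcsD2)
  have sym: "?E x y \<longleftrightarrow> ?E y x" for x y
    using arcs_symmetric by blast
  have irr: "\<not> ?E x x" for x
    using no_loops' by blast
  have NM: "\<And>n. n \<in> N \<Longrightarrow> ?E u n \<and> n \<in> pverts H \<and> n \<noteq> u"
    "\<And>m. m \<in> M \<Longrightarrow> \<not> ?E u m \<and> m \<in> pverts H \<and> m \<noteq> u"
    using irr by (auto simp: N_def M_def in_arcsD2)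
  consider "N = {}" | n where "N = {n}" | n1 n2 where "n1 \<in> N" "n2 \<in> N" "n1 \<noteq> n2" by blast
  then show thesis
  proof cases
    case 1
    consider "M = {}" | m where "M = {m}" | m1 m2 where "m1 \<in> M" "m2 \<in> M" "m1 \<noteq> m2" by blast
    then show thesis
    proof cases
      assume "M = {}"
      then show thesis
        using edgeless[of 1] iso_single[OF assms(1)] V 1 by auto
    next
      fix m assume "M = {m}"
      then show thesis
        using edgeless[of 2] iso_two_isolated[OF assms(1), of u m] V 1 NM(2)[of m] by auto
    next
      \<comment> \<open>Here \<open>u\<close> is isolated, so two non-adjacent vertices of
        \<open>M\<close> form an independent triple with it, while three pairwise adjacent ones form
        a triangle.\<close>
      fix m1 m2 assume m: "m1 \<in> M" "m2 \<in> M" "m1 \<noteq> m2"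
      show thesis
      proof (cases "?E m1 m2 \<and> (\<forall>m \<in> M. m = m1 \<or> m = m2)")
        case True
        then have "pverts H = {m1, m2, u}" using V 1 m by auto
        then show thesis
          using linear[of 1] iso_edge_isolated[OF assms(1), of m1 m2 u] True m NM(2) sym by auto
      next
        case False
        then consider "\<not> ?E m1 m2" | m3 where "m3 \<in> M" "m3 \<noteq> m1" "m3 \<noteq> m2" by blast
        then show thesis
        proof cases
          case 1
          then show thesis using independent[of u m1 m2] m NM(2) u by metis
        next
          case 2
          then show thesis
            using independent[of u m1 m2] independent[of u m1 m3] independent[of u m2 m3]
              triangle[of m1 m2 m3] m NM(2) u by metis
        qed
      qed
    qed
  next
    case (2 n)
    note n = NM(1)[of n]
    consider "M = {}" | m where "M = {m}" | m1 m2 where "m1 \<in> M" "m2 \<in> M" "m1 \<noteq> m2" by blast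
    then show thesis
    proof cases
      assume "M = {}"
      then show thesis
        using linear[of 0] iso_edge[OF assms(1), of u n] V 2 n by auto
    next
      fix m assume m: "M = {m}"
      show thesis
      proof (cases "?E n m")
        case True
        then show thesis
          using path_3[of u n m] V 2 n m NM(2)[of m] by auto
      next
        case False
        then show thesis
          using linear[of 1] iso_edge_isolated[OF assms(1), of u n m] V 2 n m NM(2)[of m] by auto
      qed
    next
      fix m1 m2 assume m: "m1 \<in> M" "m2 \<in> M" "m1 \<noteq> m2"
      have nm: "n \<noteq> m1" "n \<noteq> m2" using 2 n m NM by blast+
      show thesis
      proof (cases "?E m1 m2")
        case False
        then show thesis using independent[of u m1 m2] m NM(2) u by metis
      next
        case True
        \<comment> \<open>Vertex \<open>n\<close> sees both \<open>m1\<close> and \<open>m2\<close>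
          (a triangle), neither (two edges) or exactly one (an induced path starting with
          \<open>u\<close>, \<open>n\<close>).\<close>
        then show thesis
          using triangle[of n m1 m2] two_edges[of u n m1 m2] path_or_cycle[of u n m1 m2]
            path_or_cycle[of u n m2 m1] m NM(2) n 2 nm sym by (metis singletonI)
      qed
    qed
  next
    case (3 n1 n2)
    note n = NM(1)[OF 3(1)] NM(1)[OF 3(2)]
    show thesis
    proof (cases "?E n1 n2")
      case True
      then show thesis using triangle[of u n1 n2] n by blast
    next
      case False
      show thesis
      proof (cases "M = {} \<and> (\<forall>n \<in> N. n = n1 \<or> n = n2)")
        case True
        then have "pverts H = {n1, u, n2}" using V 3 by auto
        then show thesis using path_3[of n1 u n2] False n 3 sym by blast
      next
        case nonempty: False
        then consider n3 where "n3 \<in> N" "n3 \<noteq> n1" "n3 \<noteq> n2" | m where "m \<in> M" by blast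
        then show thesis
        proof cases
          case (1 n3)
          then show thesis
            using triangle[of u n1 n3] triangle[of u n2 n3] independent[of n1 n2 n3]
              n NM(1)[OF 1(1)] 3(3) False by metis
        next
          case (2 m)
          \<comment> \<open>If \<open>m\<close> sees \<open>n1\<close>, then \<open>m\<close>,
            \<open>n1\<close>, \<open>u\<close>, \<open>n2\<close> is an induced path or, if
            \<open>m\<close> also sees \<open>n2\<close>, an induced 4-cycle.\<close>
          then show thesis
            using independent[of n1 n2 m] path_or_cycle[of m n1 u n2] path_or_cycle[of m n2 u n1]
              n NM(2)[OF 2] 3(3) False sym by metis
        qed
      qed
    qed
  qed
qed

section \<open>Lower bounds from a shape that avoids \<open>H\<close>\<close>

lemma diameter_needs_bits_free_deletion:
  assumes "pair_graph H" "k \<le> 5"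
    and "\<And>S T f. inj_on f (pverts H) \<Longrightarrow> \<forall>u \<in> pverts H. k \<le> f u \<Longrightarrow>
      \<forall>u \<in> pverts H. \<forall>v \<in> pverts H. (u, v) \<in> parcs H \<longleftrightarrow> edge R S T (f u) (f v) \<Longrightarrow> False"
  shows "diameter_needs_bits (free_deletion_instances H 5) (\<lambda>n p. real n / real p)"
  using assms
  by (intro diameter_needs_bits_gadget[of R "{0..<k}"] gadget_free_deletion_instance) blast+

lemma diameter_needs_bits_connected_free_deletion:
  assumes "pair_graph H"
    and "\<And>S T f. inj_on f (pverts H) \<Longrightarrow> \<forall>u \<in> pverts H. 4 \<le> f u \<Longrightarrow>
      \<forall>u \<in> pverts H. \<forall>v \<in> pverts H. (u, v) \<in> parcs H \<longleftrightarrow> edge R S T (f u) (f v) \<Longrightarrow> False"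
  shows "diameter_needs_bits (connected_free_deletion_instances H 5) (\<lambda>n p. real n / real p)"
proof (rule diameter_needs_bits_gadget[of R "{0..<4}"])
  fix n :: nat and S T assume n: "5 < n"
  have "(gadget R n S T, {0..<4}) \<in> free_deletion_instances H 5 n"
    using assms n by (intro gadget_free_deletion_instance) auto
  with connected_gadget[OF n] show "(gadget R n S T, {0..<4}) \<in> connected_free_deletion_instances H 5 n"
    by (simp add: connected_free_deletion_instances_def)
qed

theorem theorem3:
  fixes H :: "'h pair_pre_digraph"
  assumes "pair_graph H"
    and "pverts H \<noteq> {}"
    and "\<forall>s \<in> {0, 1, 2}.
      \<not> digraph_iso (with_proj H)
          (with_proj (disjoint_union (path_graph 2) (copies s (path_graph 1))))"
    and "\<forall>s \<in> {1, 2, 3}.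
      \<not> digraph_iso (with_proj H) (with_proj (copies s (path_graph 1)))"
  shows "(\<exists>k. diameter_needs_bits (free_deletion_instances H k) (\<lambda>n p. real n / real p)) \<and>
    (\<not> digraph_iso (with_proj H) (with_proj (path_graph 3)) \<longrightarrow>
      (\<exists>k. diameter_needs_bits (connected_free_deletion_instances H k)
        (\<lambda>n p. real n / real p)))"
proof -
  interpret pair_graph H by fact
  \<comment> \<open>A shape that avoids \<open>H\<close> with the hub kept yields both claims from
    the same gadget.\<close>
  have both: ?thesis if "\<And>S T f. inj_on f (pverts H) \<Longrightarrow> \<forall>u \<in> pverts H. 4 \<le> f u \<Longrightarrow>
      \<forall>u \<in> pverts H. \<forall>v \<in> pverts H. (u, v) \<in> parcs H \<longleftrightarrow> edge R S T (f u) (f v) \<Longrightarrow> False" for R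
  proof -
    have "diameter_needs_bits (free_deletion_instances H 5) (\<lambda>n p. real n / real p)"
      by (rule diameter_needs_bits_free_deletion[OF assms(1), where k = 4 and R = R])
        (simp, rule that)
    moreover have
      "diameter_needs_bits (connected_free_deletion_instances H 5) (\<lambda>n p. real n / real p)"
      by (rule diameter_needs_bits_connected_free_deletion[OF assms(1), where R = R]) (rule that)
    ultimately show ?thesis by blast
  qed
  from assms(1,2) show ?thesis
  proof (cases rule: small_graph_cases)
    case (independent x y z)
    let ?R = "\<lparr> clique_odd = True, clique_even = True, hub_even = False \<rparr>"
    show ?thesis
    proof (rule both[of ?R])
      fix S T f
      assume f: "inj_on f (pverts H)" "\<forall>u \<in> pverts H. 4 \<le> f u"
        "\<forall>u \<in> pverts H. \<forall>v \<in> pverts H. (u, v) \<in> parcs H \<longleftrightarrow> edge ?R S T (f u) (f v)"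
      show False
        using two_cliques_no_independent_triple[of ?R "f x" "f y" "f z" S T] independent f
        by (simp add: inj_on_eq_iff)
    qed
  next
    case (triangle x y z)
    let ?R = "\<lparr> clique_odd = False, clique_even = False, hub_even = False \<rparr>"
    have V: "x \<in> pverts H" "y \<in> pverts H" "z \<in> pverts H"
      using triangle in_arcsD1 in_arcsD2 by blast+
    show ?thesis
    proof (rule both[of ?R])
      fix S T f
      assume f: "\<forall>u \<in> pverts H. 4 \<le> f u"
        "\<forall>u \<in> pverts H. \<forall>v \<in> pverts H. (u, v) \<in> parcs H \<longleftrightarrow> edge ?R S T (f u) (f v)"
      show False
        using spider_no_triangle[of ?R "f x" "f y" "f z" S T] triangle V f by simp
    qed
  next
    case (two_edges a b c d)
    let ?R = "\<lparr> clique_odd = True, clique_even = False, hub_even = False \<rparr>"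
    have V: "a \<in> pverts H" "b \<in> pverts H" "c \<in> pverts H" "d \<in> pverts H"
      using two_edges in_arcsD1 in_arcsD2 by blast+
    show ?thesis
    proof (rule both[of ?R])
      fix S T f
      assume f: "inj_on f (pverts H)" "\<forall>u \<in> pverts H. 4 \<le> f u"
        "\<forall>u \<in> pverts H. \<forall>v \<in> pverts H. (u, v) \<in> parcs H \<longleftrightarrow> edge ?R S T (f u) (f v)"
      show False
        using split_no_two_edges[of ?R "f a" "f b" "f c" "f d" S T] two_edges V f
        by (simp add: inj_on_eq_iff)
    qed
  next
    case (path_or_cycle a b c d)
    let ?R = "\<lparr> clique_odd = False, clique_even = False, hub_even = True \<rparr>"
    have V: "a \<in> pverts H" "b \<in> pverts H" "c \<in> pverts H" "d \<in> pverts H"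
      using path_or_cycle in_arcsD1 in_arcsD2 by blast+
    show ?thesis
    proof (rule both[of ?R])
      fix S T f
      assume f: "inj_on f (pverts H)" "\<forall>u \<in> pverts H. 4 \<le> f u"
        "\<forall>u \<in> pverts H. \<forall>v \<in> pverts H. (u, v) \<in> parcs H \<longleftrightarrow> edge ?R S T (f u) (f v)"
      show False
        using friendship_no_path[of ?R "f a" "f b" "f c" "f d" S T] path_or_cycle V f
        by (simp add: inj_on_eq_iff)
    qed
  next
    case (path_3 x y z)
    let ?R = "\<lparr> clique_odd = False, clique_even = False, hub_even = False \<rparr>"
    have "diameter_needs_bits (free_deletion_instances H 5) (\<lambda>n p. real n / real p)"
    \<comment> \<open>\<open>order_refl\<close> sets \<open>k\<close> to 5, so that the hub
      \<open>4\<close> is deleted as well.\<close>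
    proof (rule diameter_needs_bits_free_deletion[OF assms(1) order_refl, where R = ?R])
      fix S T f
      assume f: "inj_on f (pverts H)" "\<forall>u \<in> pverts H. 5 \<le> f u"
        "\<forall>u \<in> pverts H. \<forall>v \<in> pverts H. (u, v) \<in> parcs H \<longleftrightarrow> edge ?R S T (f u) (f v)"
      show False
        using matching_no_path[of ?R "f x" "f y" "f z" S T] path_3 f
        by (simp add: inj_on_eq_iff)
    qed
    \<comment> \<open>The second claim is vacuous, as \<open>H\<close> is isomorphic to
      \<open>path_graph 3\<close>.\<close>
    with iso_path_3[OF assms(1) path_3] show ?thesis by blast
  next
    case (linear s)
    with assms(3) show ?thesis by blast
  next
    case (edgeless s)
    with assms(4) show ?thesis by blast
  qed
qed

end
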